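(* If the transition operators $(P_{s,t})_{(s,t)\in\Delta}$ are $m$-polynomial, then they form a strongly continuous evolution system on $(\mathscr{P}_k(S),\|\cdot\|_k)$ for every $0\le k\le m$.
   Context: Fix $T>0$ and let $\Delta=\{(s,t):0\le s\le t\le T\}$. The state space $S\subset\mathbb{R}^d$ is measurable, with Borel $\sigma$-algebra $\mathcal{S}$. Transition operators $(P_{s,t})_{(s,t)\in\Delta}$ are given by $P_{s,t}f(x)=\int_S f(\xi)\,p_{s,t}(x,d\xi)$, where $p$ is a transition probability function: $p_{s,t}(x,A)$ is jointly measurable in $(s,t,x)$ for each $A\in\mathcal{S}$; $p_{s,t}(x,\cdot)$ is a probability measure on $\mathcal{S}$; $p_{t,t}(x,\cdot)=\delta_x$; and $p_{s,u}(x,A)=\int_S p_{s,t}(x,dy)\,p_{t,u}(y,A)$ for $0\le s\le t\le u\le T$. For a multi-index $\mathbf{k}\in\mathbb{N}_0^d$ write $|\mathbf{k}|=k_1+\dots+k_d$ and $x^{\mathbf{k}}=x_1^{k_1}\cdots x_d^{k_d}$. $\mathscr{P}_k(S)$ is the finite-dimensional space of functions $S\ni x\mapsto\sum_{|\mathbf{l}|=0}^k\alpha_{\mathbf{l}}x^{\mathbf{l}}$ with $\alpha_{\mathbf{l}}\in\mathbb{R}$. Its norm is $\|f\|_k=\inf_{\alpha}\max_{0\le|\mathbf{l}|\le k}|\alpha_{\mathbf{l}}|$, the infimum being over all coefficient families $\alpha$ with $f(x)=\sum_{|\mathbf{l}|=0}^k\alpha_{\mathbf{l}}x^{\mathbf{l}}$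 on $S$. $\tilde{\mathscr{P}}_k(S)$ is the space of functions $\Delta\times S\ni(s,t,x)\mapsto\sum_{|\mathbf{l}|=0}^k\alpha_{\mathbf{l}}(s,t)x^{\mathbf{l}}$ with $\alpha_{\mathbf{l}}\in C^1(\Delta,\mathbb{R})$, the once continuously differentiable functions $\Delta\to\mathbb{R}$. The transition operators are called $m$-polynomial if for all $k\in\{0,\dots,m\}$ and all $f\in\mathscr{P}_k(S)$ the map $(s,t,x)\mapsto P_{s,t}f(x)$ is in $\tilde{\mathscr{P}}_k(S)$. It is implicitly assumed that $P_{s,t}|f|(x)<\infty$ for all $f\in\mathscr{P}_m(S)$, $x\in S$, $(s,t)\in\Delta$. A two-parameter family $(U_{s,t})_{(s,t)\in\Delta}$ of bounded linear operators on a Banach space $(B,\|\cdot\|)$ is an evolution system if $U_{s,s}=I$ for all $0\le s\le T$ and $U_{r,s}U_{s,t}=U_{r,t}$ for all $0\le r\le s\le t\le T$. It is strongly continuous if for each $(s,t)\in\Delta$ and $f\in B$, $\lim_{\Delta\ni(v,w)\to(s,t)}\|U_{v,w}f-U_{s,t}f\|=0$. *)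

theory Defs
  imports "HOL-Probability.Probability" "HOL-Library.Function_Algebras"
begin

instantiation "fun" :: (type, real_vector) real_vector
begin

definition scaleR_fun :: "real \<Rightarrow> ('a \<Rightarrow> 'b) \<Rightarrow> 'a \<Rightarrow> 'b"
  where "scaleR_fun c f = (\<lambda>x. c *\<^sub>R f x)"

instance
  by standard (auto simp: scaleR_fun_def fun_eq_iff scaleR_add_right scaleR_add_left)

end

definition triangle :: "real \<Rightarrow> (real \<times> real) set"
  where "triangle T = {(s, t). 0 \<le> s \<and> s \<le> t \<and> t \<le> T}"

text \<open>
  Differentiability is relative to \<open>D\<close>, so that it makes sense at boundary points; on a convex set
  with nonempty interior, such as the triangle, the derivative is unique.
\<close>
definition C1_on :: "'a::real_normed_vector set \<Rightarrow> ('a \<Rightarrow> 'b::real_normed_vector) \<Rightarrow> bool"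
  where "C1_on D f \<longleftrightarrow>
    (\<exists>f' :: 'a \<Rightarrow> 'a \<Rightarrow>\<^sub>L 'b.
      (\<forall>z\<in>D. (f has_derivative blinfun_apply (f' z)) (at z within D)) \<and> continuous_on D f')"

definition multi_degree :: "('d::finite \<Rightarrow> nat) \<Rightarrow> nat"
  where "multi_degree l = (\<Sum>i\<in>UNIV. l i)"

definition multi_indices :: "nat \<Rightarrow> ('d::finite \<Rightarrow> nat) set"
  where "multi_indices k = {l. multi_degree l \<le> k}"

definition monomial :: "('d::finite \<Rightarrow> nat) \<Rightarrow> real ^ 'd \<Rightarrow> real"
  where "monomial l x = (\<Prod>i\<in>UNIV. (x $ i) ^ l i)"

text \<open>
  A function on \<open>S\<close> is encoded by its extension by \<open>0\<close> to the whole type. Thus equality of functions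
  on \<open>S\<close> is equality in HOL, and the pointwise operations of the type are those of functions on \<open>S\<close>.
\<close>
definition zero_ext :: "'a set \<Rightarrow> ('a \<Rightarrow> real) \<Rightarrow> 'a \<Rightarrow> real"
  where "zero_ext S f = (\<lambda>x. if x \<in> S then f x else 0)"

definition poly_coeffs ::
  "(real ^ 'd::finite) set \<Rightarrow> nat \<Rightarrow> (real ^ 'd \<Rightarrow> real) \<Rightarrow> (('d \<Rightarrow> nat) \<Rightarrow> real) set"
  where "poly_coeffs S k f =
    {\<alpha>. \<forall>x\<in>S. f x = (\<Sum>l\<in>multi_indices k. \<alpha> l * monomial l x)}"

definition poly_space :: "(real ^ 'd::finite) set \<Rightarrow> nat \<Rightarrow> (real ^ 'd \<Rightarrow> real) set"
  where "poly_space S k =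
    {zero_ext S (\<lambda>x. \<Sum>l\<in>multi_indices k. \<alpha> l * monomial l x) | \<alpha>. True}"

definition poly_norm :: "(real ^ 'd::finite) set \<Rightarrow> nat \<Rightarrow> (real ^ 'd \<Rightarrow> real) \<Rightarrow> real"
  where "poly_norm S k f =
    (INF \<alpha>\<in>poly_coeffs S k f. Max ((\<lambda>l. \<bar>\<alpha> l\<bar>) ` multi_indices k))"

text \<open>Only the values on \<open>triangle T \<times> S\<close> matter for membership.\<close>
definition poly_space_C1 ::
  "real \<Rightarrow> (real ^ 'd::finite) set \<Rightarrow> nat \<Rightarrow> (real \<Rightarrow> real \<Rightarrow> real ^ 'd \<Rightarrow> real) set"
  where "poly_space_C1 T S k =
    {F. \<exists>\<alpha> :: ('d \<Rightarrow> nat) \<Rightarrow> real \<times> real \<Rightarrow> real.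
      (\<forall>l\<in>multi_indices k. C1_on (triangle T) (\<alpha> l)) \<and>
      (\<forall>(s, t)\<in>triangle T. \<forall>x\<in>S.
        F s t x = (\<Sum>l\<in>multi_indices k. \<alpha> l (s, t) * monomial l x))}"

definition transition_function ::
  "real \<Rightarrow> (real ^ 'd::finite) set \<Rightarrow> (real \<Rightarrow> real \<Rightarrow> real ^ 'd \<Rightarrow> (real ^ 'd) measure) \<Rightarrow> bool"
  where "transition_function T S p \<longleftrightarrow>
    (\<forall>A\<in>sets (restrict_space borel S).
      (\<lambda>((s, t), x). emeasure (p s t x) A)
        \<in> borel_measurable (restrict_space borel (triangle T) \<Otimes>\<^sub>M restrict_space borel S)) \<and>
    (\<forall>(s, t)\<in>triangle T. \<forall>x\<in>S.
      prob_space (p s t x) \<and> sets (p s t x) = sets (restrict_space borel S)) \<and>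
    (\<forall>t\<in>{0..T}. \<forall>x\<in>S. p t t x = return (restrict_space borel S) x) \<and>
    (\<forall>s t u. 0 \<le> s \<and> s \<le> t \<and> t \<le> u \<and> u \<le> T \<longrightarrow>
      (\<forall>x\<in>S. \<forall>A\<in>sets (restrict_space borel S).
        emeasure (p s u x) A = (\<integral>\<^sup>+ y. emeasure (p t u y) A \<partial>p s t x)))"

definition transition_op ::
  "(real ^ 'd::finite) set \<Rightarrow> (real \<Rightarrow> real \<Rightarrow> real ^ 'd \<Rightarrow> (real ^ 'd) measure) \<Rightarrow>
    real \<Rightarrow> real \<Rightarrow> (real ^ 'd \<Rightarrow> real) \<Rightarrow> real ^ 'd \<Rightarrow> real"
  where "transition_op S p s t f = zero_ext S (\<lambda>x. \<integral>\<xi>. f \<xi> \<partial>p s t x)"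

text \<open>
  The first conjunct is the integrability that is tacitly part of the notion; without it the Bochner
  integral would silently be \<open>0\<close>.
\<close>
definition m_polynomial ::
  "real \<Rightarrow> (real ^ 'd::finite) set \<Rightarrow> (real \<Rightarrow> real \<Rightarrow> real ^ 'd \<Rightarrow> (real ^ 'd) measure) \<Rightarrow>
    nat \<Rightarrow> bool"
  where "m_polynomial T S p m \<longleftrightarrow>
    (\<forall>f\<in>poly_space S m. \<forall>(s, t)\<in>triangle T. \<forall>x\<in>S.
      (\<integral>\<^sup>+ \<xi>. ennreal \<bar>f \<xi>\<bar> \<partial>p s t x) < \<infinity>) \<and>
    (\<forall>k\<le>m. \<forall>f\<in>poly_space S k. (\<lambda>s t. transition_op S p s t f) \<in> poly_space_C1 T S k)"

text \<open>
  Banach spaces are given by a carrier and a norm, not by a type class, since the carrier and the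
  norm of the polynomial spaces depend on the set \<open>S\<close> and on the degree. Nothing is required of
  \<open>N\<close> outside of \<open>B\<close>.
\<close>
definition banach_on :: "'v::real_vector set \<Rightarrow> ('v \<Rightarrow> real) \<Rightarrow> bool"
  where "banach_on B N \<longleftrightarrow>
    subspace B \<and>
    (\<forall>f\<in>B. 0 \<le> N f \<and> (N f = 0 \<longleftrightarrow> f = 0)) \<and>
    (\<forall>c. \<forall>f\<in>B. N (c *\<^sub>R f) = \<bar>c\<bar> * N f) \<and>
    (\<forall>f\<in>B. \<forall>g\<in>B. N (f + g) \<le> N f + N g) \<and>
    (\<forall>X :: nat \<Rightarrow> 'v. (\<forall>n. X n \<in> B) \<and>
        (\<forall>e>0. \<exists>M. \<forall>i\<ge>M. \<forall>j\<ge>M. N (X i - X j) < e) \<longrightarrow>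
      (\<exists>f\<in>B. (\<lambda>n. N (X n - f)) \<longlonglongrightarrow> 0))"

definition bounded_linear_op_on :: "'v::real_vector set \<Rightarrow> ('v \<Rightarrow> real) \<Rightarrow> ('v \<Rightarrow> 'v) \<Rightarrow> bool"
  where "bounded_linear_op_on B N A \<longleftrightarrow>
    (\<forall>f\<in>B. A f \<in> B) \<and>
    (\<forall>f\<in>B. \<forall>g\<in>B. A (f + g) = A f + A g) \<and>
    (\<forall>c. \<forall>f\<in>B. A (c *\<^sub>R f) = c *\<^sub>R A f) \<and>
    (\<exists>C. \<forall>f\<in>B. N (A f) \<le> C * N f)"

definition evolution_system ::
  "real \<Rightarrow> 'v::real_vector set \<Rightarrow> ('v \<Rightarrow> real) \<Rightarrow> (real \<Rightarrow> real \<Rightarrow> 'v \<Rightarrow> 'v) \<Rightarrow> bool"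
  where "evolution_system T B N U \<longleftrightarrow>
    banach_on B N \<and>
    (\<forall>(s, t)\<in>triangle T. bounded_linear_op_on B N (U s t)) \<and>
    (\<forall>s\<in>{0..T}. \<forall>f\<in>B. U s s f = f) \<and>
    (\<forall>r s t. 0 \<le> r \<and> r \<le> s \<and> s \<le> t \<and> t \<le> T \<longrightarrow> (\<forall>f\<in>B. U r s (U s t f) = U r t f))"

definition strongly_continuous ::
  "real \<Rightarrow> 'v::real_vector set \<Rightarrow> ('v \<Rightarrow> real) \<Rightarrow> (real \<Rightarrow> real \<Rightarrow> 'v \<Rightarrow> 'v) \<Rightarrow> bool"
  where "strongly_continuous T B N U \<longleftrightarrow>
    (\<forall>(s, t)\<in>triangle T. \<forall>f\<in>B.
      ((\<lambda>(v, w). N (U v w f - U s t f)) \<longlongrightarrow> 0) (at (s, t) within triangle T))"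

end

theory Submission imports Defs begin

text \<open>
  The norm on \<open>poly_space S k\<close> is the quotient of the maximum norm on coefficient vectors by those
  vanishing on \<open>S\<close>, so estimates for arbitrary coefficients pass to the infimum. A linear operator
  is bounded by its values on the finitely many monomials, and the coefficients of \<open>P s t f\<close> are
  continuous in \<open>(s, t)\<close>, whence strong continuity. The composition law is Fubini's theorem for the
  Chapman-Kolmogorov kernel, extended from nonnegative functions to polynomials by integrability.
\<close>

section \<open>Polynomial spaces\<close>

lemma finite_multi_indices [simp]: "finite (multi_indices k :: ('d::finite \<Rightarrow> nat) set)"
proof (rule finite_subset)
  show "(multi_indices k :: ('d \<Rightarrow> nat) set) \<subseteq> UNIV \<rightarrow>\<^sub>E {..k}"
  proof
    fix l :: "'d \<Rightarrow> nat"
    assume "l \<in> multi_indices k"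
    then have "sum l UNIV \<le> k" by (simp add: multi_indices_def multi_degree_def)
    then have "l i \<le> k" for i
      using member_le_sum[of i UNIV l] by simp
    then show "l \<in> UNIV \<rightarrow>\<^sub>E {..k}" by (simp add: PiE_def)
  qed
  show "finite ((UNIV :: 'd set) \<rightarrow>\<^sub>E {..k})" by (intro finite_PiE) auto
qed

lemma multi_indices_nonempty [simp]: "multi_indices k \<noteq> {}"
proof -
  have "(\<lambda>_. 0) \<in> multi_indices k" by (simp add: multi_indices_def multi_degree_def)
  then show ?thesis by blast
qed

lemma multi_indices_mono: "j \<le> k \<Longrightarrow> multi_indices j \<subseteq> multi_indices k"
  by (auto simp: multi_indices_def)

text \<open>The linear map from coefficient vectors onto the polynomial space. Monomials may be
  linearly dependent on \<open>S\<close>, so it can send different coefficients on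
  \<open>multi_indices k\<close> to the same function.\<close>

definition poly_fun ::
  "(real ^ 'd::finite) set \<Rightarrow> nat \<Rightarrow> (('d \<Rightarrow> nat) \<Rightarrow> real) \<Rightarrow> real ^ 'd \<Rightarrow> real"
  where "poly_fun S k \<alpha> = zero_ext S (\<lambda>x. \<Sum>l\<in>multi_indices k. \<alpha> l * monomial l x)"

lemma poly_space_eq: "poly_space S k = range (poly_fun S k)"
  by (auto simp: poly_space_def poly_fun_def)

lemma poly_fun_in_poly_space [simp]: "poly_fun S k \<alpha> \<in> poly_space S k"
  by (simp add: poly_space_eq)

lemma poly_fun_add: "poly_fun S k \<alpha> + poly_fun S k \<beta> = poly_fun S k (\<lambda>l. \<alpha> l + \<beta> l)"
  by (auto simp: fun_eq_iff poly_fun_def zero_ext_def sum.distrib algebra_simps)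

lemma poly_fun_diff: "poly_fun S k \<alpha> - poly_fun S k \<beta> = poly_fun S k (\<lambda>l. \<alpha> l - \<beta> l)"
  by (auto simp: fun_eq_iff poly_fun_def zero_ext_def sum_subtractf algebra_simps)

lemma poly_fun_scaleR: "c *\<^sub>R poly_fun S k \<alpha> = poly_fun S k (\<lambda>l. c * \<alpha> l)"
  by (auto simp: fun_eq_iff poly_fun_def zero_ext_def scaleR_fun_def sum_distrib_left algebra_simps)

lemma poly_fun_zero: "poly_fun S k (\<lambda>_. 0) = 0"
  by (auto simp: fun_eq_iff poly_fun_def zero_ext_def)

lemma subspace_poly_space: "subspace (poly_space S k)"
proof (rule subspaceI)
  show "0 \<in> poly_space S k" by (metis poly_fun_zero poly_fun_in_poly_space)
qed (auto simp: poly_space_eq poly_fun_add poly_fun_scaleR)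

lemma poly_fun_mono:
  assumes "j \<le> k"
  shows "poly_fun S j \<alpha> = poly_fun S k (\<lambda>l. if l \<in> multi_indices j then \<alpha> l else 0)"
proof -
  have "(\<Sum>l\<in>multi_indices j. \<alpha> l * monomial l x) =
      (\<Sum>l\<in>multi_indices k. (if l \<in> multi_indices j then \<alpha> l else 0) * monomial l x)" for x
    using multi_indices_mono[OF assms] by (intro sum.mono_neutral_cong_left) auto
  then show ?thesis by (simp add: poly_fun_def)
qed

text \<open>Carries integrability, which is assumed in degree \<open>m\<close>, to every lower
  degree.\<close>

lemma poly_space_mono: "j \<le> k \<Longrightarrow> poly_space S j \<subseteq> poly_space S k"
  using poly_fun_mono[of j k S] by (auto simp: poly_space_eq)

section \<open>Representing coefficients and the infimum norm\<close>

lemma poly_coeffs_poly_fun: "\<alpha> \<in> poly_coeffs S k (poly_fun S k \<alpha>)"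
  by (simp add: poly_coeffs_def poly_fun_def zero_ext_def)

text \<open>Both functions vanish off \<open>S\<close> by the encoding, so agreement on
  \<open>S\<close> is equality.\<close>

lemma poly_coeffs_imp_eq:
  assumes "f \<in> poly_space S k" "\<alpha> \<in> poly_coeffs S k f"
  shows "f = poly_fun S k \<alpha>"
proof
  fix x
  show "f x = poly_fun S k \<alpha> x"
    using assms by (cases "x \<in> S") (auto simp: poly_space_eq poly_coeffs_def poly_fun_def zero_ext_def)
qed

text \<open>Infima of reals are meaningful only for sets bounded below; here \<open>0\<close> is a
  bound, each maximum being over a nonempty set of absolute values.\<close>

lemma poly_norm_bdd_below:
  "bdd_below ((\<lambda>\<alpha>. Max ((\<lambda>l. \<bar>\<alpha> l\<bar>) ` multi_indices k)) ` A)"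
  for A :: "(('d::finite \<Rightarrow> nat) \<Rightarrow> real) set"
proof (rule bdd_belowI2)
  fix \<alpha> :: "('d \<Rightarrow> nat) \<Rightarrow> real"
  obtain l :: "'d \<Rightarrow> nat" where "l \<in> multi_indices k"
    using multi_indices_nonempty by blast
  then show "0 \<le> Max ((\<lambda>l. \<bar>\<alpha> l\<bar>) ` multi_indices k)"
    by (subst Max_ge_iff) auto
qed

lemma poly_norm_le:
  assumes "\<And>l. l \<in> multi_indices k \<Longrightarrow> \<bar>\<alpha> l\<bar> \<le> C"
  shows "poly_norm S k (poly_fun S k \<alpha>) \<le> C"
proof -
  have "poly_norm S k (poly_fun S k \<alpha>) \<le> Max ((\<lambda>l. \<bar>\<alpha> l\<bar>) ` multi_indices k)"
    unfolding poly_norm_def by (rule cINF_lower[OF poly_norm_bdd_below poly_coeffs_poly_fun])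
  also have "\<dots> \<le> C" using assms by simp
  finally show ?thesis .
qed

text \<open>Some representation undercuts any number strictly above the infimum. The inequality is
  strict because attainment of the infimum is not claimed.\<close>

lemma poly_norm_less_imp_coeffs:
  assumes "f \<in> poly_space S k" "poly_norm S k f < C"
  obtains \<alpha> where "f = poly_fun S k \<alpha>" "\<And>l. l \<in> multi_indices k \<Longrightarrow> \<bar>\<alpha> l\<bar> < C"
proof -
  have "poly_coeffs S k f \<noteq> {}"
    using assms(1) poly_coeffs_poly_fun by (force simp: poly_space_eq)
  then obtain \<alpha> where "\<alpha> \<in> poly_coeffs S k f" "Max ((\<lambda>l. \<bar>\<alpha> l\<bar>) ` multi_indices k) < C"
    using assms(2) unfolding poly_norm_def
    by (subst (asm) cINF_less_iff[OF _ poly_norm_bdd_below]) auto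
  then show thesis
    using that[OF poly_coeffs_imp_eq[OF assms(1)]] by simp
qed

text \<open>Every \<open>C\<close> above the norm bounds the coefficients of some representation, so
  \<open>D\<close> lies below all such \<open>C\<close>. Later estimates are thus proved for one
  arbitrary \<open>\<alpha>\<close> with bound \<open>C\<close>.\<close>

lemma le_poly_normI:
  assumes "f \<in> poly_space S k"
    and "\<And>\<alpha> C. f = poly_fun S k \<alpha> \<Longrightarrow> (\<And>l. l \<in> multi_indices k \<Longrightarrow> \<bar>\<alpha> l\<bar> \<le> C) \<Longrightarrow> D \<le> C"
  shows "D \<le> poly_norm S k f"
proof (rule dense_ge)
  fix C assume "poly_norm S k f < C"
  then obtain \<alpha> where "f = poly_fun S k \<alpha>" "\<And>l. l \<in> multi_indices k \<Longrightarrow> \<bar>\<alpha> l\<bar> < C"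
    using poly_norm_less_imp_coeffs[OF assms(1)] by metis
  then show "D \<le> C" using assms(2)[of \<alpha> C] by (simp add: less_imp_le)
qed

text \<open>Point evaluations are bounded for the norm, which gives definiteness: if the norm is
  \<open>0\<close>, every value is \<open>0\<close>. The summand \<open>1\<close> makes the factor
  visibly positive, so that it can be divided out before \<open>le_poly_normI\<close> is
  applied.\<close>

lemma abs_le_poly_norm:
  assumes "f \<in> poly_space S k"
  shows "\<bar>f x\<bar> \<le> poly_norm S k f * (1 + (\<Sum>l\<in>multi_indices k. \<bar>monomial l x\<bar>))"
proof -
  define M where "M = 1 + (\<Sum>l\<in>multi_indices k. \<bar>monomial l x\<bar>)"
  have M: "M > 0" unfolding M_def by (intro add_pos_nonneg sum_nonneg) auto
  have "\<bar>f x\<bar> / M \<le> poly_norm S k f"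
  proof (rule le_poly_normI[OF assms])
    fix \<alpha> C
    assume f: "f = poly_fun S k \<alpha>" and \<alpha>: "\<And>l. l \<in> multi_indices k \<Longrightarrow> \<bar>\<alpha> l\<bar> \<le> C"
    have C: "0 \<le> C" using \<alpha> multi_indices_nonempty by (meson abs_ge_zero all_not_in_conv order_trans)
    have "\<bar>f x\<bar> \<le> \<bar>\<Sum>l\<in>multi_indices k. \<alpha> l * monomial l x\<bar>"
      by (simp add: f poly_fun_def zero_ext_def)
    also have "\<dots> \<le> (\<Sum>l\<in>multi_indices k. C * \<bar>monomial l x\<bar>)"
      using \<alpha> by (intro order_trans[OF sum_abs] sum_mono) (auto simp: abs_mult intro: mult_right_mono)
    also have "\<dots> \<le> C * M" using C by (simp add: M_def sum_distrib_left[symmetric] mult_left_mono)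
    finally show "\<bar>f x\<bar> / M \<le> C" using M by (simp add: divide_simps)
  qed
  then show ?thesis using M by (simp add: M_def[symmetric] divide_simps)
qed

lemma poly_norm_nonneg:
  assumes "f \<in> poly_space S k"
  shows "0 \<le> poly_norm S k f"
  by (rule le_poly_normI[OF assms])
    (meson abs_ge_zero all_not_in_conv order_trans multi_indices_nonempty)

lemma poly_norm_eq_0_iff:
  assumes "f \<in> poly_space S k"
  shows "poly_norm S k f = 0 \<longleftrightarrow> f = 0"
proof
  assume "poly_norm S k f = 0"
  then show "f = 0" using abs_le_poly_norm[OF assms] by (simp add: fun_eq_iff)
next
  assume "f = 0"
  then have "poly_norm S k f \<le> 0"
    using poly_norm_le[of k "\<lambda>_. 0" 0 S] by (simp add: poly_fun_zero)
  then show "poly_norm S k f = 0" using poly_norm_nonneg[OF assms] by simp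
qed

lemma poly_norm_zero: "poly_norm S k 0 = 0"
  using poly_norm_eq_0_iff[OF subspace_0[OF subspace_poly_space]] by blast

text \<open>Coefficients of \<open>f\<close> and \<open>g\<close> add up to coefficients of
  \<open>f + g\<close>. The infima over the two representations are taken one after the other, with
  the other term moved to the left.\<close>

lemma poly_norm_add:
  assumes "f \<in> poly_space S k" "g \<in> poly_space S k"
  shows "poly_norm S k (f + g) \<le> poly_norm S k f + poly_norm S k g"
proof -
  have "poly_norm S k (f + g) - poly_norm S k g \<le> poly_norm S k f"
  proof (rule le_poly_normI[OF assms(1)])
    fix \<alpha> C
    assume f: "f = poly_fun S k \<alpha>" "\<And>l. l \<in> multi_indices k \<Longrightarrow> \<bar>\<alpha> l\<bar> \<le> C"
    have "poly_norm S k (f + g) - C \<le> poly_norm S k g"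
    proof (rule le_poly_normI[OF assms(2)])
      fix \<beta> D
      assume g: "g = poly_fun S k \<beta>" "\<And>l. l \<in> multi_indices k \<Longrightarrow> \<bar>\<beta> l\<bar> \<le> D"
      have "poly_norm S k (f + g) \<le> C + D"
        unfolding f(1) g(1) poly_fun_add
        by (rule poly_norm_le) (rule order_trans[OF abs_triangle_ineq add_mono[OF f(2) g(2)]])
      then show "poly_norm S k (f + g) - C \<le> D" by simp
    qed
    then show "poly_norm S k (f + g) - poly_norm S k g \<le> C" by simp
  qed
  then show ?thesis by simp
qed

lemma poly_norm_scaleR:
  assumes "f \<in> poly_space S k"
  shows "poly_norm S k (c *\<^sub>R f) = \<bar>c\<bar> * poly_norm S k f"
proof -
  have le: "poly_norm S k (c *\<^sub>R f) \<le> \<bar>c\<bar> * poly_norm S k f" if "c \<noteq> 0" "f \<in> poly_space S k" for c f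
  proof -
    have "poly_norm S k (c *\<^sub>R f) / \<bar>c\<bar> \<le> poly_norm S k f"
    proof (rule le_poly_normI[OF that(2)])
      fix \<alpha> C
      assume f: "f = poly_fun S k \<alpha>" "\<And>l. l \<in> multi_indices k \<Longrightarrow> \<bar>\<alpha> l\<bar> \<le> C"
      have "poly_norm S k (c *\<^sub>R f) \<le> \<bar>c\<bar> * C"
        unfolding f(1) poly_fun_scaleR
        by (rule poly_norm_le) (simp add: abs_mult mult_left_mono f(2))
      then show "poly_norm S k (c *\<^sub>R f) / \<bar>c\<bar> \<le> C" using that(1) by (simp add: divide_simps mult.commute)
    qed
    then show ?thesis using that(1) by (simp add: divide_simps mult.commute)
  qed
  show ?thesis
  proof (cases "c = 0")
    case True
    then show ?thesis by (simp add: poly_norm_zero)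
  next
    case False
    \<comment> \<open>The reverse inequality is \<open>le\<close> for the factor
      \<open>inverse c\<close> and the function \<open>c *\<^sub>R f\<close>.\<close>
    have "poly_norm S k (inverse c *\<^sub>R (c *\<^sub>R f)) \<le> \<bar>inverse c\<bar> * poly_norm S k (c *\<^sub>R f)"
      using False assms by (intro le subspace_scale[OF subspace_poly_space]) auto
    then have "\<bar>c\<bar> * poly_norm S k f \<le> poly_norm S k (c *\<^sub>R f)"
      using False by (simp add: divide_simps mult.commute abs_inverse)
    with le[OF False assms] show ?thesis by simp
  qed
qed

lemma poly_norm_sum_le:
  assumes "finite A" "\<And>a. a \<in> A \<Longrightarrow> f a \<in> poly_space S k"
  shows "poly_norm S k (\<Sum>a\<in>A. f a) \<le> (\<Sum>a\<in>A. poly_norm S k (f a))"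
  using assms
proof (induction A rule: finite_induct)
  case empty
  show ?case using poly_norm_zero[of S k] by (simp add: zero_fun_def)
next
  case (insert a A)
  then have "sum f A \<in> poly_space S k" by (intro subspace_sum[OF subspace_poly_space]) auto
  then have "poly_norm S k (f a + sum f A) \<le> poly_norm S k (f a) + (\<Sum>a\<in>A. poly_norm S k (f a))"
    using poly_norm_add[of "f a" S k "sum f A"] insert by force
  then show ?case using insert.hyps by (simp add: plus_fun_def)
qed

text \<open>
  Coefficient vectors of a Cauchy sequence can be chosen bounded, hence along a subsequence
  convergent.
\<close>
lemma poly_space_complete:
  assumes X: "\<And>n. X n \<in> poly_space S k"
    and cauchy: "\<And>e. e > 0 \<Longrightarrow> \<exists>M::nat. \<forall>i\<ge>M. \<forall>j\<ge>M. poly_norm S k (X i - X j) < e"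
  shows "\<exists>f\<in>poly_space S k. (\<lambda>n. poly_norm S k (X n - f)) \<longlonglongrightarrow> 0"
proof -
  note diff = subspace_diff[OF subspace_poly_space]
  obtain M where M: "\<And>i. i \<ge> M \<Longrightarrow> poly_norm S k (X i - X M) < 1"
    using cauchy[of 1] by auto
  \<comment> \<open>From index \<open>M\<close> on, the sequence stays within \<open>1\<close> of
    \<open>X M\<close>, so its norms are below \<open>C\<close> and coefficients bounded by
    \<open>C\<close> exist. The shift \<open>n + M\<close> drops the earlier members.\<close>
  define C where "C = poly_norm S k (X M) + 1"
  have "\<exists>\<alpha>. X (n + M) = poly_fun S k \<alpha> \<and> (\<forall>l\<in>multi_indices k. \<bar>\<alpha> l\<bar> \<le> C)" for n
  proof -
    have "poly_norm S k ((X (n + M) - X M) + X M) < C"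
      using poly_norm_add[OF diff[OF X X] X, of "n + M" M M] M[of "n + M"] by (simp add: C_def)
    then have "poly_norm S k (X (n + M)) < C" by simp
    from poly_norm_less_imp_coeffs[OF X this] show ?thesis by (metis less_imp_le)
  qed
  then obtain A where A: "\<And>n. X (n + M) = poly_fun S k (A n)"
    and A_le: "\<And>n l. l \<in> multi_indices k \<Longrightarrow> \<bar>A n l\<bar> \<le> C"
    by metis
  \<comment> \<open>Bolzano-Weierstrass in finitely many coordinates: one subsequence
    \<open>r\<close> serves all multi-indices at once.\<close>
  have "\<forall>\<delta>\<subseteq>multi_indices k. \<exists>\<alpha>. \<exists>r::nat\<Rightarrow>nat. strict_mono r \<and>
      (\<forall>\<epsilon>>0. eventually (\<lambda>n. \<forall>i\<in>\<delta>. dist (A (r n) i) (\<alpha> i) < \<epsilon>) sequentially)"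
  proof (rule compact_lemma_general[where unproj = "\<lambda>x. x"])
    show "bounded ((\<lambda>x. x l) ` range A)" if "l \<in> multi_indices k" for l
      using A_le[OF that] by (auto simp: bounded_iff)
  qed auto
  then obtain \<alpha> r where r: "strict_mono r"
    and lim: "\<And>e. e > 0 \<Longrightarrow> \<forall>\<^sub>F n in sequentially. \<forall>l\<in>multi_indices k. dist (A (r n) l) (\<alpha> l) < e"
    by blast
  define f where "f = poly_fun S k \<alpha>"
  have f: "f \<in> poly_space S k" by (simp add: f_def)
  have "(\<lambda>n. poly_norm S k (X n - f)) \<longlonglongrightarrow> 0"
  proof (rule LIMSEQ_I)
    fix e :: real assume e: "e > 0"
    obtain K where K: "\<And>i j. i \<ge> K \<Longrightarrow> j \<ge> K \<Longrightarrow> poly_norm S k (X i - X j) < e / 2"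
      using cauchy[of "e / 2"] e by auto
    obtain N where N: "\<And>n. n \<ge> N \<Longrightarrow> \<forall>l\<in>multi_indices k. dist (A (r n) l) (\<alpha> l) < e / 2"
      using lim[of "e / 2"] e by (auto simp: eventually_sequentially)
    \<comment> \<open>A single member of the subsequence suffices: it is within \<open>e / 2\<close>
      of \<open>f\<close> since \<open>n \<ge> N\<close>, and its index is at least \<open>K\<close>
      since \<open>r n \<ge> n\<close>. The Cauchy property then covers all
      \<open>i \<ge> K\<close>.\<close>
    define n where "n = max N K"
    have "poly_norm S k (X (r n + M) - f) \<le> e / 2"
      unfolding A f_def poly_fun_diff using N[of n]
      by (intro poly_norm_le) (auto simp: dist_real_def n_def less_imp_le)
    moreover have "r n + M \<ge> K" using seq_suble[OF r, of n] by (simp add: n_def)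
    ultimately have "poly_norm S k (X i - f) < e" if "i \<ge> K" for i
      using poly_norm_add[OF diff[OF X X] diff[OF X f], of i "r n + M" "r n + M"] K[OF that]
      by fastforce
    then show "\<exists>K. \<forall>i\<ge>K. norm (poly_norm S k (X i - f) - 0) < e"
      using poly_norm_nonneg[OF diff[OF X f]] by auto
  qed
  with f show ?thesis by blast
qed

lemma banach_on_poly_space: "banach_on (poly_space S k) (poly_norm S k)"
  unfolding banach_on_def
  by (intro conjI allI ballI impI subspace_poly_space poly_space_complete)
    (auto simp: poly_norm_nonneg poly_norm_eq_0_iff poly_norm_scaleR poly_norm_add)

text \<open>For coefficients bounded by \<open>C\<close>, the norm of \<open>A f\<close> is at most
  \<open>C\<close> times the sum of the norms of the images of the monomials. This works for every
  representation of \<open>f\<close>, so no basis has to be selected.\<close>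

lemma poly_space_bounded_linear_op:
  assumes maps: "\<And>f. f \<in> poly_space S k \<Longrightarrow> A f \<in> poly_space S k"
    and add: "\<And>f g. f \<in> poly_space S k \<Longrightarrow> g \<in> poly_space S k \<Longrightarrow> A (f + g) = A f + A g"
    and scale: "\<And>c f. f \<in> poly_space S k \<Longrightarrow> A (c *\<^sub>R f) = c *\<^sub>R A f"
  shows "bounded_linear_op_on (poly_space S k) (poly_norm S k) A"
proof -
  let ?I = "multi_indices k"
  \<comment> \<open>The monomial of index \<open>l\<close> as an element of the space; for
    \<open>l\<close> outside \<open>?I\<close> it is the zero function.\<close>
  define e where "e l = poly_fun S k (\<lambda>j. if j = l then 1 else 0)" for l
  have e: "e l \<in> poly_space S k" for l by (simp add: e_def)
  note sub = subspace_poly_space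
  have A_sum: "A (\<Sum>l\<in>J. \<alpha> l *\<^sub>R e l) = (\<Sum>l\<in>J. \<alpha> l *\<^sub>R A (e l))" if "finite J" for J \<alpha>
    using that
  proof (induction J rule: finite_induct)
    case empty
    show ?case using scale[of 0 0] subspace_0[OF sub, of S k] by (simp add: zero_fun_def)
  next
    case (insert l J)
    have "A (\<alpha> l *\<^sub>R e l + (\<Sum>l\<in>J. \<alpha> l *\<^sub>R e l)) = \<alpha> l *\<^sub>R A (e l) + (\<Sum>l\<in>J. \<alpha> l *\<^sub>R A (e l))"
      using insert.IH by (simp only: add scale e subspace_scale[OF sub] subspace_sum[OF sub])
    then show ?case using insert.hyps by (simp add: plus_fun_def)
  qed
  have expand: "poly_fun S k \<alpha> = (\<Sum>l\<in>?I. \<alpha> l *\<^sub>R e l)" for \<alpha>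
  proof
    fix x
    have ev: "e l x = (if x \<in> S then monomial l x else 0)" if "l \<in> ?I" for l
      using that by (simp add: e_def poly_fun_def zero_ext_def mult_delta_left)
    have "(\<Sum>l\<in>J. \<alpha> l *\<^sub>R e l) x = (\<Sum>l\<in>J. \<alpha> l * e l x)" for J
      by (induction J rule: infinite_finite_induct) (auto simp: scaleR_fun_def)
    then show "poly_fun S k \<alpha> x = (\<Sum>l\<in>?I. \<alpha> l *\<^sub>R e l) x"
      by (auto simp: ev poly_fun_def zero_ext_def intro!: sum.cong)
  qed
  \<comment> \<open>The summand \<open>1\<close> keeps \<open>K\<close> positive even if
    \<open>A\<close> annihilates all monomials.\<close>
  define K where "K = 1 + (\<Sum>l\<in>?I. poly_norm S k (A (e l)))"
  have nonneg: "0 \<le> poly_norm S k (A (e l))" for l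
    by (intro poly_norm_nonneg maps e)
  have K: "K > 0" unfolding K_def by (intro add_pos_nonneg sum_nonneg nonneg) auto
  have "poly_norm S k (A f) \<le> K * poly_norm S k f" if f: "f \<in> poly_space S k" for f
  proof -
    have "poly_norm S k (A f) / K \<le> poly_norm S k f"
    proof (rule le_poly_normI[OF f])
      fix \<alpha> C
      assume f: "f = poly_fun S k \<alpha>" and \<alpha>: "\<And>l. l \<in> ?I \<Longrightarrow> \<bar>\<alpha> l\<bar> \<le> C"
      have C: "0 \<le> C" using \<alpha> multi_indices_nonempty by (meson abs_ge_zero all_not_in_conv order_trans)
      have "poly_norm S k (A f) \<le> (\<Sum>l\<in>?I. poly_norm S k (\<alpha> l *\<^sub>R A (e l)))"
        unfolding f expand A_sum[OF finite_multi_indices]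
        by (intro poly_norm_sum_le) (auto intro: subspace_scale[OF sub] maps e)
      also have "\<dots> \<le> (\<Sum>l\<in>?I. C * poly_norm S k (A (e l)))"
        by (intro sum_mono) (simp add: poly_norm_scaleR maps e mult_right_mono \<alpha> nonneg)
      also have "\<dots> \<le> C * K" using C by (simp add: K_def sum_distrib_left[symmetric] mult_left_mono)
      finally show "poly_norm S k (A f) / K \<le> C" using K by (simp add: divide_simps)
    qed
    then show ?thesis using K by (simp add: divide_simps mult.commute)
  qed
  then show ?thesis
    unfolding bounded_linear_op_on_def using maps add scale by blast
qed

section \<open>Transition operators\<close>

text \<open>Fubini for a kernel and a function that may be unbounded, as polynomials on
  \<open>S\<close> may be. The positive and the negative part are treated separately by the law for
  nonnegative integrals; integrability makes their difference meaningful.\<close>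

lemma integral_bind_real:
  fixes f :: "'b \<Rightarrow> real"
  assumes N [measurable]: "N \<in> M \<rightarrow>\<^sub>M subprob_algebra B"
    and f [measurable]: "f \<in> borel_measurable B"
    and int: "integrable (M \<bind> N) f"
    and int': "\<And>y. y \<in> space M \<Longrightarrow> integrable (N y) f"
  shows "(\<integral>x. f x \<partial>(M \<bind> N)) = (\<integral>y. (\<integral>x. f x \<partial>N y) \<partial>M)"
proof -
  \<comment> \<open>As \<open>ennreal\<close> sends negative numbers to \<open>0\<close>,
    \<open>g f\<close> integrates the positive part of \<open>f\<close>, and
    \<open>g (\<lambda>x. - f x)\<close> the negative part.\<close>
  define g where "g h y = (\<integral>\<^sup>+x. ennreal (h x) \<partial>N y)" for h :: "'b \<Rightarrow> real" and y
  have meas [measurable]: "g h \<in> borel_measurable M" if [measurable]: "h \<in> borel_measurable B" for h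
    unfolding g_def by measurable
  have part: "integrable M (\<lambda>y. enn2real (g h y)) \<and>
      (\<integral>y. enn2real (g h y) \<partial>M) = enn2real (\<integral>\<^sup>+x. ennreal (h x) \<partial>(M \<bind> N))"
    if h [measurable]: "h \<in> borel_measurable B" and inth: "integrable (M \<bind> N) h"
      and inth': "\<And>y. y \<in> space M \<Longrightarrow> integrable (N y) h" for h
  proof -
    \<comment> \<open>\<open>enn2real\<close> sends \<open>\<infinity>\<close> to \<open>0\<close>,
      so finiteness is what makes the passage to reals and back faithful.\<close>
    have fin: "g h y < \<infinity>" if "y \<in> space M" for y
      using inth'[OF that] by (simp add: g_def real_integrable_def less_top)
    have eq: "(\<integral>\<^sup>+y. ennreal (enn2real (g h y)) \<partial>M) = (\<integral>\<^sup>+x. ennreal (h x) \<partial>(M \<bind> N))"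
      using fin by (subst nn_integral_bind[OF _ N]) (auto simp: g_def intro!: nn_integral_cong)
    moreover have "(\<integral>\<^sup>+x. ennreal (h x) \<partial>(M \<bind> N)) < \<infinity>"
      using inth by (simp add: real_integrable_def less_top)
    ultimately show ?thesis
      by (auto intro!: integrableI_nonneg simp: integral_eq_nn_integral)
  qed
  have "(\<integral>y. (\<integral>x. f x \<partial>N y) \<partial>M) = (\<integral>y. enn2real (g f y) - enn2real (g (\<lambda>x. - f x) y) \<partial>M)"
    by (intro Bochner_Integration.integral_cong refl) (simp add: g_def real_lebesgue_integral_def int')
  also have "\<dots> = (\<integral>x. f x \<partial>(M \<bind> N))"
    using part[of f] part[of "\<lambda>x. - f x"] int int' by (simp add: real_lebesgue_integral_def)
  finally show ?thesis ..
qed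

lemma borel_measurable_poly_space:
  assumes "f \<in> poly_space S k"
  shows "f \<in> borel_measurable (restrict_space borel S)"
proof -
  obtain \<alpha> where f: "f = poly_fun S k \<alpha>" using assms by (auto simp: poly_space_eq)
  have "(\<lambda>x :: real ^ 'a. \<Sum>l\<in>multi_indices k. \<alpha> l * monomial l x) \<in> borel_measurable borel"
    unfolding monomial_def by measurable
  then have "(\<lambda>x. \<Sum>l\<in>multi_indices k. \<alpha> l * monomial l x) \<in> borel_measurable (restrict_space borel S)"
    by (rule measurable_restrict_space1)
  then show ?thesis
    by (rule measurable_cong[THEN iffD1, rotated])
      (simp add: f poly_fun_def zero_ext_def space_restrict_space)
qed

section \<open>Transition functions as kernels and the Chapman-Kolmogorov equation\<close>

context
  fixes T :: real and S :: "(real ^ 'd::finite) set"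
    and p :: "real \<Rightarrow> real \<Rightarrow> real ^ 'd \<Rightarrow> (real ^ 'd) measure"
  assumes trans: "transition_function T S p"
begin

lemma transition_prob_space:
  "(s, t) \<in> triangle T \<Longrightarrow> x \<in> S \<Longrightarrow> prob_space (p s t x)"
  using trans by (auto simp: transition_function_def)

lemma transition_sets:
  "(s, t) \<in> triangle T \<Longrightarrow> x \<in> S \<Longrightarrow> sets (p s t x) = sets (restrict_space borel S)"
  using trans by (auto simp: transition_function_def)

lemma transition_space:
  "(s, t) \<in> triangle T \<Longrightarrow> x \<in> S \<Longrightarrow> space (p s t x) = S"
  using sets_eq_imp_space_eq[OF transition_sets] by (simp add: space_restrict_space)

text \<open>Joint measurability is specialised to fixed times by composing with the embedding
  \<open>x \<mapsto> ((s, t), x)\<close>.\<close>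

lemma transition_kernel:
  assumes "(s, t) \<in> triangle T"
  shows "p s t \<in> restrict_space borel S \<rightarrow>\<^sub>M subprob_algebra (restrict_space borel S)"
proof (rule measurable_subprob_algebra)
  fix x assume "x \<in> space (restrict_space borel S)"
  then have x: "x \<in> S" by (simp add: space_restrict_space)
  show "subprob_space (p s t x)"
    by (rule prob_space_imp_subprob_space[OF transition_prob_space[OF assms x]])
  show "sets (p s t x) = sets (restrict_space borel S)" by (rule transition_sets[OF assms x])
next
  fix A assume A: "A \<in> sets (restrict_space borel S)"
  have "(\<lambda>x. ((s, t), x)) \<in> restrict_space borel S \<rightarrow>\<^sub>M
      restrict_space borel (triangle T) \<Otimes>\<^sub>M restrict_space borel S"
    using assms by (intro measurable_Pair1') (simp add: space_restrict_space)
  moreover have "(\<lambda>((s, t), x). emeasure (p s t x) A)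
      \<in> borel_measurable (restrict_space borel (triangle T) \<Otimes>\<^sub>M restrict_space borel S)"
    using trans A by (simp add: transition_function_def)
  ultimately show "(\<lambda>x. emeasure (p s t x) A) \<in> borel_measurable (restrict_space borel S)"
    by (rule measurable_compose[THEN measurable_cong[THEN iffD1, rotated]]) simp
qed

text \<open>The Chapman-Kolmogorov equation in monadic form, to which Fubini for kernels
  applies.\<close>

lemma transition_bind:
  assumes "0 \<le> r" "r \<le> s" "s \<le> t" "t \<le> T" "x \<in> S"
  shows "p r t x = p r s x \<bind> p s t"
proof (rule measure_eqI)
  have tri: "(r, s) \<in> triangle T" "(s, t) \<in> triangle T" "(r, t) \<in> triangle T"
    using assms by (auto simp: triangle_def)
  \<comment> \<open>The rules for \<open>bind\<close> require a nonempty space; the point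
    \<open>x\<close> of \<open>S\<close> is a witness.\<close>
  have ne: "space (p r s x) \<noteq> {}" using transition_space[OF tri(1)] assms by auto
  have ker: "p s t \<in> p r s x \<rightarrow>\<^sub>M subprob_algebra (restrict_space borel S)"
    using transition_kernel[OF tri(2)] transition_sets[OF tri(1)] assms
    by (simp cong: measurable_cong_sets)
  show "sets (p r t x) = sets (p r s x \<bind> p s t)"
    using sets_bind[OF sets_kernel[OF ker] ne] transition_sets[OF tri(3)] assms by simp
  fix A assume "A \<in> sets (p r t x)"
  then have A: "A \<in> sets (restrict_space borel S)" using transition_sets[OF tri(3)] assms by simp
  show "emeasure (p r t x) A = emeasure (p r s x \<bind> p s t) A"
    using trans assms A by (simp add: emeasure_bind[OF ne ker A] transition_function_def)
qed

text \<open>Integration against the point mass at \<open>x\<close> evaluates at \<open>x\<close>;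
  off \<open>S\<close> both sides are \<open>0\<close>.\<close>

lemma transition_op_refl:
  assumes "s \<in> {0..T}" "f \<in> poly_space S k"
  shows "transition_op S p s s f = f"
proof
  fix x
  show "transition_op S p s s f x = f x"
  proof (cases "x \<in> S")
    case True
    then have "p s s x = return (restrict_space borel S) x"
      using trans assms by (simp add: transition_function_def)
    then show ?thesis
      using True assms
      by (simp add: transition_op_def zero_ext_def integral_return borel_measurable_poly_space
          space_restrict_space)
  next
    case False
    then show ?thesis
      using assms(2) by (auto simp: transition_op_def poly_space_eq poly_fun_def zero_ext_def)
  qed
qed

section \<open>Action of the transition operators on polynomials of degree at most
  \<open>m\<close>\<close>

context
  fixes m :: nat
  assumes poly: "m_polynomial T S p m"
begin

lemma transition_integrable:
  assumes "f \<in> poly_space S m" "(s, t) \<in> triangle T" "x \<in> S"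
  shows "integrable (p s t x) f"
proof (rule integrableI_bounded)
  show "f \<in> borel_measurable (p s t x)"
    using borel_measurable_poly_space[OF assms(1)] transition_sets[OF assms(2,3)]
    by (simp cong: measurable_cong_sets)
  show "(\<integral>\<^sup>+ x. ennreal (norm (f x)) \<partial>p s t x) < \<infinity>"
    using poly assms unfolding m_polynomial_def real_norm_def by blast
qed

text \<open>One family of coefficient functions serves the whole triangle. This yields both the
  invariance of the polynomial space and the continuity in \<open>(s, t)\<close>.\<close>

lemma transition_op_coeffs:
  assumes "k \<le> m" "f \<in> poly_space S k"
  obtains \<alpha> where "\<And>l. l \<in> multi_indices k \<Longrightarrow> C1_on (triangle T) (\<alpha> l)"
    and "\<And>s t. (s, t) \<in> triangle T \<Longrightarrow> transition_op S p s t f = poly_fun S k (\<lambda>l. \<alpha> l (s, t))"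
proof -
  have "(\<lambda>s t. transition_op S p s t f) \<in> poly_space_C1 T S k"
    using poly assms by (simp add: m_polynomial_def)
  then obtain \<alpha> where \<alpha>: "\<And>l. l \<in> multi_indices k \<Longrightarrow> C1_on (triangle T) (\<alpha> l)"
    and eq: "\<And>s t x. (s, t) \<in> triangle T \<Longrightarrow> x \<in> S \<Longrightarrow>
      transition_op S p s t f x = (\<Sum>l\<in>multi_indices k. \<alpha> l (s, t) * monomial l x)"
    unfolding poly_space_C1_def by blast
  have "transition_op S p s t f = poly_fun S k (\<lambda>l. \<alpha> l (s, t))" if "(s, t) \<in> triangle T" for s t
    using eq[OF that] by (fastforce simp: fun_eq_iff poly_fun_def zero_ext_def transition_op_def)
  with \<alpha> show thesis by (rule that)
qed

lemma transition_op_in_poly_space: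
  "k \<le> m \<Longrightarrow> f \<in> poly_space S k \<Longrightarrow> (s, t) \<in> triangle T \<Longrightarrow> transition_op S p s t f \<in> poly_space S k"
  using transition_op_coeffs by (metis poly_fun_in_poly_space)

text \<open>Integrability makes the Bochner integral additive on the space; boundedness then follows
  from finitely many monomials.\<close>

lemma transition_op_bounded_linear:
  assumes "k \<le> m" "(s, t) \<in> triangle T"
  shows "bounded_linear_op_on (poly_space S k) (poly_norm S k) (transition_op S p s t)"
proof (rule poly_space_bounded_linear_op)
  fix f assume f: "f \<in> poly_space S k"
  have int: "integrable (p s t x) h" if "h \<in> poly_space S k" "x \<in> S" for h x
    using transition_integrable poly_space_mono[OF assms(1)] that assms(2) by blast
  show "transition_op S p s t f \<in> poly_space S k"
    by (rule transition_op_in_poly_space[OF assms(1) f assms(2)])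
  show "transition_op S p s t (f + g) = transition_op S p s t f + transition_op S p s t g"
    if "g \<in> poly_space S k" for g
    using int f that by (auto simp: fun_eq_iff transition_op_def zero_ext_def)
  show "transition_op S p s t (c *\<^sub>R f) = c *\<^sub>R transition_op S p s t f" for c
    by (auto simp: fun_eq_iff transition_op_def zero_ext_def scaleR_fun_def)
qed

lemma transition_op_compose:
  assumes "0 \<le> r" "r \<le> s" "s \<le> t" "t \<le> T" "f \<in> poly_space S m"
  shows "transition_op S p r s (transition_op S p s t f) = transition_op S p r t f"
proof -
  have tri: "(r, s) \<in> triangle T" "(s, t) \<in> triangle T" "(r, t) \<in> triangle T"
    using assms by (auto simp: triangle_def)
  have "(\<integral>y. transition_op S p s t f y \<partial>p r s x) = (\<integral>y. f y \<partial>p r t x)" if x: "x \<in> S" for x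
  proof -
    have ker: "p s t \<in> p r s x \<rightarrow>\<^sub>M subprob_algebra (restrict_space borel S)"
      using transition_kernel[OF tri(2)] transition_sets[OF tri(1) x]
      by (simp cong: measurable_cong_sets)
    have bind: "p r t x = p r s x \<bind> p s t" using assms x by (intro transition_bind)
    \<comment> \<open>The zero extension disappears under the outer integral because the space of
      \<open>p r s x\<close> is \<open>S\<close>.\<close>
    have "(\<integral>y. transition_op S p s t f y \<partial>p r s x) = (\<integral>y. (\<integral>z. f z \<partial>p s t y) \<partial>p r s x)"
      using transition_space[OF tri(1) x]
      by (intro Bochner_Integration.integral_cong) (auto simp: transition_op_def zero_ext_def)
    also have "\<dots> = (\<integral>y. f y \<partial>p r t x)"
      unfolding bind
    proof (rule integral_bind_real[OF ker, symmetric])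
      show "f \<in> borel_measurable (restrict_space borel S)"
        by (rule borel_measurable_poly_space[OF assms(5)])
      show "integrable (p r s x \<bind> p s t) f"
        using transition_integrable[OF assms(5) tri(3) x] by (simp add: bind)
      show "integrable (p s t y) f" if "y \<in> space (p r s x)" for y
        using transition_integrable[OF assms(5) tri(2)] that transition_space[OF tri(1) x] by simp
    qed
    finally show ?thesis .
  qed
  then show ?thesis
    unfolding transition_op_def[of S p r s] transition_op_def[of S p r t]
    by (auto simp: fun_eq_iff zero_ext_def)
qed

lemma transition_op_evolution_system:
  assumes "k \<le> m"
  shows "evolution_system T (poly_space S k) (poly_norm S k) (transition_op S p)"
  unfolding evolution_system_def
  using banach_on_poly_space transition_op_bounded_linear[OF assms] transition_op_refl
    transition_op_compose poly_space_mono[OF assms, of S]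
  by (auto 0 3)

lemma transition_op_strongly_continuous:
  assumes "k \<le> m"
  shows "strongly_continuous T (poly_space S k) (poly_norm S k) (transition_op S p)"
  unfolding strongly_continuous_def
proof safe
  fix s t f
  assume st: "(s, t) \<in> triangle T" and f: "f \<in> poly_space S k"
  obtain \<alpha> where C1: "\<And>l. l \<in> multi_indices k \<Longrightarrow> C1_on (triangle T) (\<alpha> l)"
    and op: "\<And>s t. (s, t) \<in> triangle T \<Longrightarrow> transition_op S p s t f = poly_fun S k (\<lambda>l. \<alpha> l (s, t))"
    using transition_op_coeffs[OF assms f] by blast
  let ?F = "at (s, t) within triangle T"
  \<comment> \<open>Differentiability within the triangle gives continuity within it.\<close>
  have "(\<alpha> l \<longlongrightarrow> \<alpha> l (s, t)) ?F" if "l \<in> multi_indices k" for l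
    using C1[OF that] st unfolding C1_on_def
    by (meson continuous_within has_derivative_continuous)
  then have "((\<lambda>z. \<Sum>l\<in>multi_indices k. \<bar>\<alpha> l z - \<alpha> l (s, t)\<bar>) \<longlongrightarrow>
      (\<Sum>l\<in>multi_indices k. \<bar>\<alpha> l (s, t) - \<alpha> l (s, t)\<bar>)) ?F"
    by (intro tendsto_intros)
  then have lim: "((\<lambda>z. \<Sum>l\<in>multi_indices k. \<bar>\<alpha> l z - \<alpha> l (s, t)\<bar>) \<longlongrightarrow> 0) ?F"
    by simp
  \<comment> \<open>The coefficient differences represent the difference of the two functions, and
    each of them is at most their absolute sum, which tends to \<open>0\<close> by
    \<open>lim\<close>.\<close>
  have bounds: "0 \<le> poly_norm S k (transition_op S p v w f - transition_op S p s t f) \<and>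
      poly_norm S k (transition_op S p v w f - transition_op S p s t f)
        \<le> (\<Sum>l\<in>multi_indices k. \<bar>\<alpha> l (v, w) - \<alpha> l (s, t)\<bar>)" if "(v, w) \<in> triangle T" for v w
    unfolding op[OF that] op[OF st] poly_fun_diff
    by (auto intro!: poly_norm_nonneg poly_norm_le
        member_le_sum[where f = "\<lambda>l. \<bar>\<alpha> l (v, w) - \<alpha> l (s, t)\<bar>"])
  show "((\<lambda>(v, w). poly_norm S k (transition_op S p v w f - transition_op S p s t f)) \<longlongrightarrow> 0) ?F"
    by (rule tendsto_sandwich[OF _ _ tendsto_const lim])
      (auto simp: eventually_at_filter bounds intro!: always_eventually)
qed

end

end

theorem proposition3p2:
  fixes T :: real
    and S :: "(real ^ 'd::finite) set"
    and p :: "real \<Rightarrow> real \<Rightarrow> real ^ 'd \<Rightarrow> (real ^ 'd) measure"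
    and m :: nat
  assumes "T > 0"
    and "S \<in> sets borel"
    and "transition_function T S p"
    and "m_polynomial T S p m"
  shows "\<forall>k\<le>m.
    evolution_system T (poly_space S k) (poly_norm S k) (transition_op S p) \<and>
    strongly_continuous T (poly_space S k) (poly_norm S k) (transition_op S p)"
  using transition_op_evolution_system[OF assms(3,4)]
    transition_op_strongly_continuous[OF assms(3,4)]
  by blast

end
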